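(* For an arbitrary non-dyadic partition $\alpha$, the function $\theta_\alpha$ is singular with respect to the Lebesgue measure $\lambda$; that is, for $\lambda$-almost every $x\in[0,1]$ the derivative $\theta_\alpha'(x)$ exists and is equal to $0$.
   Context: $\mathbb N=\{1,2,3,\dots\}$, $\lambda$ is Lebesgue measure. Let $\alpha=\{A_n:n\in\mathbb N\}$ be a countably infinite partition of the unit interval (i.e. of $(0,1]$) into non-empty, left-open, right-closed intervals, ordered from right to left starting from $A_1$ and accumulating only at $0$. Put $a_n:=\lambda(A_n)$ and $t_n:=\sum_{k\ge n}a_k$, so $t_1=1$ and $A_n=(t_{n+1},t_n]$. The dyadic partition is $\{(2^{-n},2^{-(n-1)}]:n\in\mathbb N\}$; $\alpha$ is non-dyadic if it is not this partition. $\alpha$-Lüroth map: $L_\alpha(x)=(t_n-x)/a_n$ for $x\in A_n$, $L_\alpha(0)=0$. Each $x\in(0,1]$ has an $\alpha$-Lüroth expansion $x=[\ell_1,\ell_2,\dots]_\alpha:=\sum_{n\ge1}(-1)^{n-1}\bigl(\prod_{i<n}a_{\ell_i}\bigr)t_{\ell_n}$, where $L_\alpha^{k-1}(x)\in A_{\ell_k}$; the sequence is finite, terminating at index $k$, when $L_\alpha^{k-1}(x)=t_n$ for some $n\ge2$ (finite sum; also $1=[1]_\alpha$). Finite expansions are two-fold: $[\ell_1,\dots,\ell_k,1]_\alpha=[\ell_1,\dots,\ell_{k-1},\ell_k+1]_\alpha$; infinite expansions are unique. $\alpha$-Farey-Minkowski function: $\theta_\alpha:[0,1]\to[0,1]$,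 $\theta_\alpha(0)=0$ and $\theta_\alpha([\ell_1,\ell_2,\dots]_\alpha)=-2\sum_{k\ge1}(-1)^k2^{-\sum_{i=1}^k\ell_i}$ (finite sum for finite expansions); it is a strictly increasing homeomorphism of $[0,1]$. *)

theory Defs
  imports "HOL-Analysis.Analysis"
begin

text \<open>
  Natural numbers start at 1 here: partitions are families \<open>A :: nat \<Rightarrow> real set\<close> of which only
  the members \<open>A n\<close> with \<open>1 \<le> n\<close> matter.
\<close>

definition luroth_partition :: "(nat \<Rightarrow> real set) \<Rightarrow> bool" where
  "luroth_partition A \<longleftrightarrow>
     partition_on {0<..1} (A ` {1..}) \<and>
     (\<forall>n\<ge>1. \<exists>l r. l < r \<and> A n = {l<..r}) \<and>
     (\<forall>m\<ge>1. \<forall>n>m. \<forall>x\<in>A n. \<forall>y\<in>A m. x < y) \<and>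
     (\<forall>c. (\<forall>e>0. infinite {n. 1 \<le> n \<and> A n \<inter> ball c e \<noteq> {}}) \<longleftrightarrow> c = 0)"

definition dyadic_partition :: "nat \<Rightarrow> real set" where
  "dyadic_partition n = {1 / 2 ^ n<..1 / 2 ^ (n - 1)}"

definition non_dyadic :: "(nat \<Rightarrow> real set) \<Rightarrow> bool" where
  "non_dyadic A \<longleftrightarrow> A ` {1..} \<noteq> dyadic_partition ` {1..}"

definition part_len :: "(nat \<Rightarrow> real set) \<Rightarrow> nat \<Rightarrow> real" where
  "part_len A n = measure lebesgue (A n)"

definition part_tail :: "(nat \<Rightarrow> real set) \<Rightarrow> nat \<Rightarrow> real" where
  "part_tail A n = (\<Sum>k. part_len A (n + k))"

definition part_index :: "(nat \<Rightarrow> real set) \<Rightarrow> real \<Rightarrow> nat" where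
  "part_index A x = (THE n. 1 \<le> n \<and> x \<in> A n)"

definition luroth_map :: "(nat \<Rightarrow> real set) \<Rightarrow> real \<Rightarrow> real" where
  "luroth_map A x =
     (if x = 0 then 0
      else (part_tail A (part_index A x) - x) / part_len A (part_index A x))"

text \<open>
  A finite or infinite digit sequence \<open>\<ell>\<^sub>1, \<ell>\<^sub>2, \<dots>\<close> of positive integers is a function \<open>d\<close> with
  \<open>d k = \<ell>\<^sub>k\<^sub>+\<^sub>1\<close>, where the value 0 (which is not a digit) marks every position behind the end
  of a finite sequence.
\<close>

definition digit_seq :: "(nat \<Rightarrow> nat) \<Rightarrow> bool" where
  "digit_seq d \<longleftrightarrow> (\<forall>k. d k = 0 \<longrightarrow> d (Suc k) = 0)"

definition luroth_value :: "(nat \<Rightarrow> real set) \<Rightarrow> (nat \<Rightarrow> nat) \<Rightarrow> real" where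
  "luroth_value A d =
     (\<Sum>n. if d n = 0 then 0
          else (-1) ^ n * (\<Prod>i<n. part_len A (d i)) * part_tail A (d n))"

text \<open>
  The expansion of \<open>x\<close> read off from its orbit. It terminates when the orbit reaches 0, that is,
  one step after it has reached a right endpoint \<open>part_tail A n\<close>. Of the two expansions of such a
  point this is the shorter one; the theorem \<open>farey_minkowski_luroth_value\<close> below shows that the
  function \<open>farey_minkowski\<close> obtained from it is given by the defining series on both.
\<close>

definition luroth_digits :: "(nat \<Rightarrow> real set) \<Rightarrow> real \<Rightarrow> nat \<Rightarrow> nat" where
  "luroth_digits A x k =
     (let y = (luroth_map A ^^ k) x in if y = 0 then 0 else part_index A y)"

text \<open>The summation index is shifted by one, hence \<open>(-1) ^ Suc k\<close>.\<close>

definition farey_value :: "(nat \<Rightarrow> nat) \<Rightarrow> real" where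
  "farey_value d =
     - 2 * (\<Sum>k. if d k = 0 then 0 else (-1) ^ Suc k * (1 / 2) ^ (\<Sum>i\<le>k. d i))"

definition farey_minkowski :: "(nat \<Rightarrow> real set) \<Rightarrow> real \<Rightarrow> real" where
  "farey_minkowski A x = (if x = 0 then 0 else farey_value (luroth_digits A x))"


section \<open>Basic properties of the partition\<close>

lemma luroth_partition_facts:
  assumes "luroth_partition A"
  shows part_tail_1: "part_tail A 1 = 1"
    and part_interval: "\<And>n. 1 \<le> n \<Longrightarrow> A n = {part_tail A (Suc n)<..part_tail A n}"
    and part_len_eq: "\<And>n. 1 \<le> n \<Longrightarrow> part_len A n = part_tail A n - part_tail A (Suc n)"
    and part_tail_less: "\<And>n. 1 \<le> n \<Longrightarrow> part_tail A (Suc n) < part_tail A n"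
    and part_tail_pos: "\<And>n. 1 \<le> n \<Longrightarrow> 0 < part_tail A n"
    and part_cover: "\<And>x. 0 < x \<Longrightarrow> x \<le> 1 \<Longrightarrow> \<exists>n\<ge>1. x \<in> A n"
    and part_order: "\<And>m n x y. 1 \<le> m \<Longrightarrow> m < n \<Longrightarrow> x \<in> A n \<Longrightarrow> y \<in> A m \<Longrightarrow> x < y"
proof -
  have U: "(\<Union>n\<in>{1..}. A n) = {0<..1}"
    using assms unfolding luroth_partition_def partition_on_def by auto
  have I: "\<forall>n\<in>{1..}. \<exists>l r. l < r \<and> A n = {l<..r}"
    using assms unfolding luroth_partition_def by auto
  show ord: "x < y" if "1 \<le> m" "m < n" "x \<in> A n" "y \<in> A m" for m n x y
    using assms that unfolding luroth_partition_def by blast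
  obtain l where "\<forall>n\<in>{1..}. \<exists>r. l n < r \<and> A n = {l n<..r}" using bchoice[OF I] by blast
  then obtain r where "\<forall>n\<in>{1..}. l n < r n \<and> A n = {l n<..r n}" using bchoice by metis
  then have lr: "\<And>n. 1 \<le> n \<Longrightarrow> l n < r n" and A: "\<And>n. 1 \<le> n \<Longrightarrow> A n = {l n<..r n}" by auto
  show cov: "\<exists>n\<ge>1. x \<in> A n" if "0 < x" "x \<le> 1" for x
  proof -
    have "x \<in> (\<Union>n\<in>{1..}. A n)" unfolding U using that by simp
    then show ?thesis by auto
  qed
  have sub: "A n \<subseteq> {0<..1}" if "1 \<le> n" for n
    unfolding U[symmetric] using that by (intro UN_upper) simp
  have disj: "A m \<inter> A n = {}" if "1 \<le> m" "m < n" for m n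
    using ord[OF that] by blast
  have rA: "r n \<in> A n" if "1 \<le> n" for n using lr A that by auto
  have tail: "(\<Union>k. A (n + k)) = {0<..r n}" if n: "1 \<le> n" for n
  proof (intro equalityI subsetI)
    fix x assume "x \<in> (\<Union>k. A (n + k))"
    then obtain k where k: "x \<in> A (n + k)" by auto
    have "x \<le> r n"
    proof (cases k)
      case 0 then show ?thesis using k A[OF n] by auto
    next
      case (Suc j)
      then have "x < r n" using ord[OF n _ k rA[OF n]] by simp
      then show ?thesis by simp
    qed
    moreover have "0 < x" using sub[of "n + k"] k n by auto
    ultimately show "x \<in> {0<..r n}" by simp
  next
    fix x assume x: "x \<in> {0<..r n}"
    have "r n \<le> 1" using sub[OF n] rA[OF n] by auto
    then obtain k where k: "1 \<le> k" "x \<in> A k" using cov x by force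
    have "\<not> k < n" using ord[OF k(1) _ rA[OF n] k(2)] x by force
    then show "x \<in> (\<Union>k. A (n + k))" using k(2) le_Suc_ex[of n k] by fastforce
  qed
  have r_pos: "0 < r n" "r n \<le> 1" if "1 \<le> n" for n using sub[OF that] rA[OF that] by auto
  have len: "part_len A n = r n - l n" if "1 \<le> n" for n
    using A[OF that] lr[OF that] by (simp add: part_len_def)
  have sums: "(\<lambda>k. part_len A (n + k)) sums r n" if n: "1 \<le> n" for n
  proof -
    have "(\<lambda>k. measure lebesgue (A (n + k))) sums measure lebesgue (\<Union>k. A (n + k))"
    proof (rule measure_UNION)
      show "range (\<lambda>k. A (n + k)) \<subseteq> sets lebesgue"
        using A n by (auto simp: trans_le_add1)
      show "disjoint_family (\<lambda>k. A (n + k))"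
        unfolding disjoint_family_on_def
      proof (intro ballI impI)
        fix i j :: nat assume "i \<noteq> j"
        then consider "i < j" | "j < i" by linarith
        then show "A (n + i) \<inter> A (n + j) = {}"
          using disj[of "n + i" "n + j"] disj[of "n + j" "n + i"] n by cases auto
      qed
      show "emeasure lebesgue (\<Union>k. A (n + k)) \<noteq> \<infinity>"
        using tail[OF n] r_pos[OF n] by simp
    qed
    then show ?thesis using tail[OF n] r_pos[OF n] by (simp add: part_len_def)
  qed
  have T: "part_tail A n = r n" if "1 \<le> n" for n
    using sums_unique[OF sums[OF that]] by (simp add: part_tail_def)
  have lS: "l n = r (Suc n)" if n: "1 \<le> n" for n
  proof -
    have "(\<lambda>k. part_len A (n + Suc k)) sums (r n - part_len A (n + 0))"
      using sums[OF n] sums_Suc_iff[of "\<lambda>k. part_len A (n + k)" "r n - part_len A n"] by simp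
    moreover have "(\<lambda>k. part_len A (n + Suc k)) sums r (Suc n)"
      using sums[of "Suc n"] by simp
    ultimately have "r n - part_len A n = r (Suc n)" using sums_unique2 by fastforce
    then show ?thesis using len[OF n] by simp
  qed
  show "A n = {part_tail A (Suc n)<..part_tail A n}" if "1 \<le> n" for n
    using A[OF that] T[OF that] T[of "Suc n"] lS[OF that] that by simp
  show "part_len A n = part_tail A n - part_tail A (Suc n)" if "1 \<le> n" for n
    using len[OF that] T[OF that] T[of "Suc n"] lS[OF that] that by simp
  show "part_tail A (Suc n) < part_tail A n" if "1 \<le> n" for n
    using lr[OF that] T[OF that] T[of "Suc n"] lS[OF that] that by simp
  show "0 < part_tail A n" if "1 \<le> n" for n using T[OF that] r_pos[OF that] by simp
  have "1 \<le> r 1"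
  proof -
    obtain k where k: "1 \<le> k" "(1::real) \<in> A k" using cov[of 1] by auto
    show ?thesis
    proof (cases "k = 1")
      case True then show ?thesis using k A[of 1] by simp
    next
      case False
      then have "1 < r 1" using ord[of 1 k 1 "r 1"] k rA[of 1] by simp
      then show ?thesis by simp
    qed
  qed
  then show "part_tail A 1 = 1" using T[of 1] r_pos[of 1] by simp
qed

context
  fixes A :: "nat \<Rightarrow> real set"
  assumes part: "luroth_partition A"
begin

lemma part_tail_antimono: "1 \<le> m \<Longrightarrow> m \<le> n \<Longrightarrow> part_tail A n \<le> part_tail A m"
proof (induction n)
  case (Suc n)
  then show ?case using part_tail_less[OF part, of n] by (cases "m = Suc n") auto
qed simp

lemma part_tail_le_1: "1 \<le> n \<Longrightarrow> part_tail A n \<le> 1"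
  using part_tail_antimono[of 1 n] part_tail_1[OF part] by simp

lemma part_len_pos: "1 \<le> n \<Longrightarrow> 0 < part_len A n"
  using part_len_eq[OF part] part_tail_less[OF part] by simp

lemma part_len_bound:
  obtains c where "0 < c" "c < 1" "\<And>n. 1 \<le> n \<Longrightarrow> part_len A n \<le> c"
proof -
  let ?c = "max (part_tail A 2) (1 - part_tail A 2)"
  have t2: "0 < part_tail A 2" "part_tail A 2 < 1"
    using part_tail_pos[OF part, of 2] part_tail_less[OF part, of 1] part_tail_1[OF part]
    by (simp_all add: numeral_2_eq_2)
  have "part_len A n \<le> ?c" if n: "1 \<le> n" for n
  proof (cases "n = 1")
    case True
    then show ?thesis using part_len_eq[OF part, of 1] part_tail_1[OF part]
      by (simp add: numeral_2_eq_2)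
  next
    case False
    then show ?thesis
      using n part_len_eq[OF part n] part_tail_pos[OF part, of "Suc n"] part_tail_antimono[of 2 n]
      by simp
  qed
  then show ?thesis using that[of ?c] t2 by auto
qed

lemma part_index_eq: "1 \<le> n \<Longrightarrow> x \<in> A n \<Longrightarrow> part_index A x = n"
  unfolding part_index_def
proof (rule the_equality)
  fix m assume "1 \<le> n" "x \<in> A n" "1 \<le> m \<and> x \<in> A m"
  then show "m = n"
    using part_order[OF part, of m n x x] part_order[OF part, of n m x x]
    by (meson less_irrefl nat_neq_iff)
qed simp

lemma luroth_map_unit:
  assumes "0 < x" "x \<le> 1"
  defines "n \<equiv> part_index A x"
  shows "1 \<le> n" "x \<in> A n" "luroth_map A x = (part_tail A n - x) / part_len A n"
    "0 \<le> luroth_map A x" "luroth_map A x < 1"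
proof -
  obtain m where m: "1 \<le> m" "x \<in> A m" using part_cover[OF part assms(1,2)] by auto
  then have "n = m" using part_index_eq n_def by simp
  then show n: "1 \<le> n" "x \<in> A n" using m by simp_all
  show L: "luroth_map A x = (part_tail A n - x) / part_len A n"
    using assms unfolding luroth_map_def n_def by simp
  show "0 \<le> luroth_map A x" "luroth_map A x < 1"
    unfolding L using n(2) part_interval[OF part n(1)] part_len_pos[OF n(1)]
      part_len_eq[OF part n(1)] by (simp_all add: divide_simps)
qed

lemma luroth_digits_0: "luroth_digits A x 0 = (if x = 0 then 0 else part_index A x)"
  by (simp add: luroth_digits_def)

lemma luroth_digits_Suc: "luroth_digits A x (Suc k) = luroth_digits A (luroth_map A x) k"
  by (simp add: luroth_digits_def funpow_swap1)

lemma luroth_digits_zero: "luroth_digits A 0 k = 0"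
  by (induction k) (simp_all add: luroth_digits_0 luroth_digits_Suc luroth_map_def)

lemma digit_seq_luroth_digits: "0 \<le> x \<Longrightarrow> x \<le> 1 \<Longrightarrow> digit_seq (luroth_digits A x)"
  unfolding digit_seq_def
proof
  fix k assume "0 \<le> x" "x \<le> 1"
  then show "luroth_digits A x k = 0 \<longrightarrow> luroth_digits A x (Suc k) = 0"
  proof (induction k arbitrary: x)
    case 0
    then show ?case
      using luroth_map_unit(1)[of x] luroth_digits_zero
      by (cases "x = 0") (auto simp: luroth_digits_0)
  next
    case (Suc k)
    then show ?case
    proof (cases "x = 0")
      case False
      then show ?thesis using Suc luroth_map_unit[of x]
        by (simp add: luroth_digits_Suc[of x])
    qed (simp add: luroth_digits_zero)
  qed
qed

end


section \<open>Expansions\<close>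

lemma digit_seq_Suc: "digit_seq d \<Longrightarrow> digit_seq (\<lambda>k. d (Suc k))"
  by (simp add: digit_seq_def)

lemma digit_seq_0: "digit_seq d \<Longrightarrow> d 0 = 0 \<Longrightarrow> d k = 0"
  by (induction k) (auto simp: digit_seq_def)

lemma digit_seq_pos: "digit_seq d \<Longrightarrow> d n \<noteq> 0 \<Longrightarrow> i \<le> n \<Longrightarrow> 1 \<le> d i"
proof (induction n)
  case (Suc n)
  have "d n \<noteq> 0" using Suc.prems(1,2) unfolding digit_seq_def by metis
  then show ?case using Suc.IH Suc.prems by (cases "i = Suc n") simp_all
qed simp

lemma digit_seq_sum: "digit_seq d \<Longrightarrow> d k \<noteq> 0 \<Longrightarrow> Suc k \<le> (\<Sum>i\<le>k. d i)"
  using sum_mono[of "{..k}" "\<lambda>_. 1" d] digit_seq_pos[of d k] by simp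

lemma farey_term_bound:
  assumes "digit_seq d"
  shows "norm (if d k = 0 then 0 else (-1) ^ Suc k * (1 / 2) ^ (\<Sum>i\<le>k. d i) :: real)
           \<le> (1 / 2) ^ Suc k"
  using digit_seq_sum[OF assms, of k] power_decreasing[of "Suc k" "\<Sum>i\<le>k. d i" "1 / 2 :: real"]
  by (auto simp: abs_mult power_abs)

lemma farey_summable:
  assumes "digit_seq d"
  shows "summable (\<lambda>k. if d k = 0 then 0 else (-1) ^ Suc k * (1 / 2) ^ (\<Sum>i\<le>k. d i) :: real)"
proof (rule summable_comparison_test')
  show "summable (\<lambda>k. (1 / 2) ^ Suc k :: real)" by (simp add: summable_geometric)
qed (use farey_term_bound[OF assms] in blast)

lemma farey_value_bound:
  assumes "digit_seq d"
  shows "\<bar>farey_value d\<bar> \<le> 2"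
proof -
  have g: "(\<lambda>k. (1 / 2) ^ Suc k :: real) sums 1" by (rule power_half_series)
  have "norm (\<Sum>k. if d k = 0 then 0 else (-1) ^ Suc k * (1 / 2) ^ (\<Sum>i\<le>k. d i) :: real)
          \<le> (\<Sum>k. (1 / 2) ^ Suc k)"
    using g by (intro norm_suminf_le farey_term_bound assms) (simp add: sums_iff)
  then show ?thesis using g by (simp add: farey_value_def sums_iff)
qed

lemma farey_value_empty: "digit_seq d \<Longrightarrow> d 0 = 0 \<Longrightarrow> farey_value d = 0"
  using digit_seq_0[of d] by (simp add: farey_value_def)

lemma farey_value_rec:
  assumes d: "digit_seq d" and "d 0 \<noteq> 0"
  shows "farey_value d = (1 / 2) ^ d 0 * (2 - farey_value (\<lambda>k. d (Suc k)))"
proof -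
  let ?f = "\<lambda>d k. if d k = 0 then 0 else (-1) ^ Suc k * (1 / 2) ^ (\<Sum>i\<le>k. d i) :: real"
  have "suminf (?f d) = ?f d 0 + (\<Sum>k. ?f d (Suc k))"
    using suminf_split_head[OF farey_summable[OF d]] by simp
  also have "(\<lambda>k. ?f d (Suc k)) = (\<lambda>k. - ((1 / 2) ^ d 0) * ?f (\<lambda>k. d (Suc k)) k)"
    by (rule ext) (simp add: sum.atMost_Suc_shift power_add del: sum.atMost_Suc)
  also have "suminf \<dots> = - ((1 / 2) ^ d 0) * suminf (?f (\<lambda>k. d (Suc k)))"
    using farey_summable[OF digit_seq_Suc[OF d]] by (rule suminf_mult)
  finally show ?thesis using assms(2) by (simp add: farey_value_def algebra_simps)
qed

context
  fixes A :: "nat \<Rightarrow> real set"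
  assumes part: "luroth_partition A"
begin

lemma luroth_summable:
  assumes d: "digit_seq d"
  shows "summable (\<lambda>n. if d n = 0 then 0
           else (-1) ^ n * (\<Prod>i<n. part_len A (d i)) * part_tail A (d n))"
proof -
  obtain c where c: "0 < c" "c < 1" "\<And>n. 1 \<le> n \<Longrightarrow> part_len A n \<le> c"
    using part_len_bound[OF part] by blast
  show ?thesis
  proof (rule summable_comparison_test')
    show "summable (\<lambda>n. c ^ n)" using c by (simp add: summable_geometric)
    fix n :: nat
    show "norm (if d n = 0 then 0
           else (-1) ^ n * (\<Prod>i<n. part_len A (d i)) * part_tail A (d n)) \<le> c ^ n"
    proof (cases "d n = 0")
      case False
      have pos: "0 < part_len A (d i) \<and> part_len A (d i) \<le> c" if "i < n" for i
        using part_len_pos[OF part] c(3) digit_seq_pos[OF d False, of i] that by simp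
      have "(\<Prod>i<n. part_len A (d i)) \<le> (\<Prod>i<n. c)"
        using pos by (intro prod_mono) (auto intro: less_imp_le)
      moreover have "0 \<le> (\<Prod>i<n. part_len A (d i))"
        using pos by (intro prod_nonneg) (auto intro: less_imp_le)
      moreover have "0 < part_tail A (d n)" "part_tail A (d n) \<le> 1"
        using part_tail_pos[OF part, of "d n"] part_tail_le_1[OF part, of "d n"] False by auto
      ultimately show ?thesis
        using False mult_mono[of "\<Prod>i<n. part_len A (d i)" "c ^ n" "part_tail A (d n)" 1] c
        by (simp add: abs_mult)
    qed (use c in simp)
  qed
qed

lemma luroth_value_empty: "digit_seq d \<Longrightarrow> d 0 = 0 \<Longrightarrow> luroth_value A d = 0"
  using digit_seq_0[of d] by (simp add: luroth_value_def)

lemma luroth_value_rec: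
  assumes d: "digit_seq d" and "d 0 \<noteq> 0"
  shows "luroth_value A d =
           part_tail A (d 0) - part_len A (d 0) * luroth_value A (\<lambda>k. d (Suc k))"
proof -
  let ?f = "\<lambda>d n. if d n = 0 then 0
              else (-1) ^ n * (\<Prod>i<n. part_len A (d i)) * part_tail A (d n)"
  have "suminf (?f d) = ?f d 0 + (\<Sum>k. ?f d (Suc k))"
    using suminf_split_head[OF luroth_summable[OF d]] by simp
  also have "(\<lambda>k. ?f d (Suc k)) = (\<lambda>k. - part_len A (d 0) * ?f (\<lambda>k. d (Suc k)) k)"
    by (rule ext) (simp add: prod.lessThan_Suc_shift del: prod.lessThan_Suc)
  also have "suminf \<dots> = - part_len A (d 0) * suminf (?f (\<lambda>k. d (Suc k)))"
    using luroth_summable[OF digit_seq_Suc[OF d]] by (rule suminf_mult)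
  finally show ?thesis using assms(2) by (simp add: luroth_value_def)
qed

lemma luroth_value_bounds:
  assumes "digit_seq d"
  shows "0 \<le> luroth_value A d" "luroth_value A d \<le> 1"
proof -
  let ?f = "\<lambda>d n. if d n = 0 then 0
              else (-1) ^ n * (\<Prod>i<n. part_len A (d i)) * part_tail A (d n)"
  have b: "0 \<le> (\<Sum>k<n. ?f d k) \<and> (\<Sum>k<n. ?f d k) \<le> 1" for n
    using assms
  proof (induction n arbitrary: d)
    case (Suc n)
    show ?case
    proof (cases "d 0 = 0")
      case True
      then show ?thesis using digit_seq_0[OF Suc.prems] by simp
    next
      case False
      let ?d = "\<lambda>k. d (Suc k)"
      let ?s = "\<Sum>k<n. ?f ?d k"
      have 1: "1 \<le> d 0" using False by simp
      have s: "0 \<le> ?s" "?s \<le> 1" using Suc.IH[OF digit_seq_Suc[OF Suc.prems]] by auto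
      have "(\<Sum>k<Suc n. ?f d k) = ?f d 0 + (\<Sum>k<n. ?f d (Suc k))"
        by (rule sum.lessThan_Suc_shift)
      also have "(\<lambda>k. ?f d (Suc k)) = (\<lambda>k. - part_len A (d 0) * ?f ?d k)"
        by (rule ext) (simp add: prod.lessThan_Suc_shift del: prod.lessThan_Suc)
      also have "(\<Sum>k<n. - part_len A (d 0) * ?f ?d k) = - part_len A (d 0) * ?s"
        by (rule sum_distrib_left[symmetric])
      finally have eq: "(\<Sum>k<Suc n. ?f d k) = part_tail A (d 0) - part_len A (d 0) * ?s"
        using False by simp
      have "0 \<le> part_len A (d 0) * ?s" "part_len A (d 0) * ?s \<le> part_len A (d 0)"
        using s part_len_pos[OF part 1] by (simp_all add: mult_left_le)
      then show ?thesis
        unfolding eq using part_len_eq[OF part 1] part_tail_pos[OF part, of "Suc (d 0)"]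
          part_tail_le_1[OF part 1] by simp
    qed
  qed simp
  have lim: "(\<lambda>n. \<Sum>k<n. ?f d k) \<longlonglongrightarrow> luroth_value A d"
    unfolding luroth_value_def by (rule summable_LIMSEQ[OF luroth_summable[OF assms]])
  show "0 \<le> luroth_value A d" by (rule LIMSEQ_le_const[OF lim]) (use b in blast)
  show "luroth_value A d \<le> 1" by (rule LIMSEQ_le_const2[OF lim]) (use b in blast)
qed

lemma luroth_value_pos:
  assumes "digit_seq d" "d 0 \<noteq> 0"
  shows "0 < luroth_value A d"
proof -
  have 1: "1 \<le> d 0" using assms by simp
  have "part_len A (d 0) * luroth_value A (\<lambda>k. d (Suc k)) \<le> part_len A (d 0)"
    using luroth_value_bounds[OF digit_seq_Suc[OF assms(1)]] part_len_pos[OF part 1]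
    by (simp add: mult_left_le)
  then show ?thesis
    using luroth_value_rec[OF assms] part_len_eq[OF part 1] part_tail_pos[OF part, of "Suc (d 0)"]
    by simp
qed

lemma luroth_value_eq_1:
  assumes d: "digit_seq d" and v: "luroth_value A d = 1"
  shows "d 0 = 1" "d (Suc 0) = 0"
proof -
  have d0: "d 0 \<noteq> 0" using luroth_value_empty[OF d] v by auto
  then have 1: "1 \<le> d 0" by simp
  let ?v = "luroth_value A (\<lambda>k. d (Suc k))"
  have eq: "1 = part_tail A (d 0) - part_len A (d 0) * ?v"
    using luroth_value_rec[OF d d0] v by simp
  show "d (Suc 0) = 0"
  proof (rule ccontr)
    assume "d (Suc 0) \<noteq> 0"
    then have "0 < ?v" using luroth_value_pos[OF digit_seq_Suc[OF d]] by simp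
    then have "0 < part_len A (d 0) * ?v" using part_len_pos[OF part 1] by simp
    then show False using eq part_tail_le_1[OF part 1] by simp
  qed
  then have "?v = 0" using luroth_value_empty[OF digit_seq_Suc[OF d]] by simp
  then have "part_tail A (d 0) = 1" using eq by simp
  moreover have "part_tail A (d 0) \<le> part_tail A (Suc 1)" if "d 0 \<noteq> 1"
    using part_tail_antimono[OF part, of "Suc 1" "d 0"] that 1 by simp
  ultimately show "d 0 = 1"
    using part_tail_less[OF part, of 1] part_tail_1[OF part] by force
qed

theorem luroth_value_luroth_digits:
  assumes "0 < x" "x \<le> 1"
  shows "luroth_value A (luroth_digits A x) = x"
proof -
  obtain c where c: "0 < c" "c < 1" "\<And>n. 1 \<le> n \<Longrightarrow> part_len A n \<le> c"
    using part_len_bound[OF part] by blast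
  have "\<bar>luroth_value A (luroth_digits A x) - x\<bar> \<le> c ^ n" if "0 \<le> x" "x \<le> 1" for n x
    using that
  proof (induction n arbitrary: x)
    case 0
    then show ?case
      using luroth_value_bounds[OF digit_seq_luroth_digits[OF part 0]] by simp
  next
    case (Suc n)
    show ?case
    proof (cases "x = 0")
      case True
      then show ?thesis
        using c luroth_value_empty[OF digit_seq_luroth_digits[OF part, of 0]]
          luroth_digits_zero[OF part, of 0] by (simp del: power_Suc)
    next
      case False
      then have x: "0 < x" using Suc.prems by simp
      define m where "m = part_index A x"
      define y where "y = luroth_map A x"
      note L = luroth_map_unit[OF part x Suc.prems(2), folded m_def y_def]
      have a: "0 < part_len A m" "part_len A m \<le> c" using part_len_pos[OF part L(1)] c(3) L(1) by auto
      have x_eq: "x = part_tail A m - part_len A m * y" using L(3) a by simp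
      have m: "luroth_digits A x 0 = m" using False by (simp add: luroth_digits_0[OF part] m_def)
      have "luroth_value A (luroth_digits A x) =
              part_tail A m - part_len A m * luroth_value A (luroth_digits A y)"
        using luroth_value_rec[OF digit_seq_luroth_digits[OF part Suc.prems]] m L(1)
        by (simp add: luroth_digits_Suc[OF part] y_def)
      moreover have "part_len A m * y = part_tail A m - x" using x_eq by linarith
      ultimately have "luroth_value A (luroth_digits A x) - x =
                   - part_len A m * (luroth_value A (luroth_digits A y) - y)"
        by (simp add: algebra_simps)
      then have "\<bar>luroth_value A (luroth_digits A x) - x\<bar> =
                   part_len A m * \<bar>luroth_value A (luroth_digits A y) - y\<bar>"
        using a by (simp add: abs_mult)
      also have "\<dots> \<le> c * c ^ n"
        using Suc.IH[of y] L(4,5) a c by (intro mult_mono) auto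
      finally show ?thesis by simp
    qed
  qed
  then have "\<bar>luroth_value A (luroth_digits A x) - x\<bar> \<le> c ^ n" for n using assms by simp
  moreover have "(\<lambda>n. c ^ n) \<longlonglongrightarrow> 0" using c by (simp add: LIMSEQ_power_zero)
  ultimately have "\<bar>luroth_value A (luroth_digits A x) - x\<bar> \<le> 0"
    using LIMSEQ_le_const by blast
  then show ?thesis by simp
qed

theorem farey_minkowski_luroth_value:
  assumes "digit_seq d"
  shows "farey_minkowski A (luroth_value A d) = farey_value d"
proof -
  have fm: "farey_minkowski A x = farey_value (luroth_digits A x)" if "0 \<le> x" "x \<le> 1" for x
    using farey_value_empty[OF digit_seq_luroth_digits[OF part that]]
    by (auto simp: farey_minkowski_def luroth_digits_0[OF part])
  have fm_rec: "farey_minkowski A x =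
      (1 / 2) ^ part_index A x * (2 - farey_minkowski A (luroth_map A x))"
    if x: "0 < x" "x \<le> 1" for x
  proof -
    have "luroth_digits A x 0 = part_index A x" using x by (simp add: luroth_digits_0[OF part])
    then show ?thesis
      using x farey_value_rec[OF digit_seq_luroth_digits[OF part, of x]] luroth_map_unit[OF part x]
      by (simp add: fm luroth_digits_Suc[OF part])
  qed
  have fm_0: "farey_minkowski A 0 = 0" by (simp add: farey_minkowski_def)
  have "\<bar>farey_minkowski A (luroth_value A d) - farey_value d\<bar> \<le> 4 * (1 / 2) ^ n"
    if "digit_seq d" for n d
    using that
  proof (induction n arbitrary: d)
    case 0
    then show ?case
      using farey_value_bound[OF 0] luroth_value_bounds[OF 0]
        farey_value_bound[OF digit_seq_luroth_digits[OF part, of "luroth_value A d"]]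
      by (simp add: fm)
  next
    case (Suc n)
    note d = \<open>digit_seq d\<close>
    let ?d = "\<lambda>k. d (Suc k)"
    define x where "x = luroth_value A d"
    define y where "y = luroth_value A ?d"
    show ?case
    proof (cases "d 0 = 0")
      case True
      then show ?thesis using luroth_value_empty[OF d] farey_value_empty[OF d] fm_0 by simp
    next
      case False
      then have 1: "1 \<le> d 0" by simp
      have x: "0 < x" "x \<le> 1"
        unfolding x_def using luroth_value_pos[OF d False] luroth_value_bounds[OF d] by auto
      have y: "0 \<le> y" "y \<le> 1"
        unfolding y_def using luroth_value_bounds[OF digit_seq_Suc[OF d]] by auto
      have xy: "x = part_tail A (d 0) - part_len A (d 0) * y"
        unfolding x_def y_def by (rule luroth_value_rec[OF d False])
      have a: "0 < part_len A (d 0)" by (rule part_len_pos[OF part 1])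
      note F = farey_value_rec[OF d False]
      show ?thesis
      proof (cases "y = 1")
        case True
        then have x_eq: "x = part_tail A (Suc (d 0))"
          using xy part_len_eq[OF part 1] by simp
        then have "x \<in> A (Suc (d 0))"
          using part_interval[OF part, of "Suc (d 0)"] part_tail_less[OF part, of "Suc (d 0)"]
          by simp
        then have i: "part_index A x = Suc (d 0)" by (simp add: part_index_eq[OF part])
        then have "luroth_map A x = 0" using x_eq by (simp add: luroth_map_def)
        then have 2: "farey_minkowski A x = (1 / 2) ^ d 0" using fm_rec[OF x] i fm_0 by simp
        have "?d 0 = 1" "?d (Suc 0) = 0"
          using luroth_value_eq_1[OF digit_seq_Suc[OF d]] True y_def by auto
        moreover have "farey_value (\<lambda>k. ?d (Suc k)) = 0"
          using farey_value_empty[OF digit_seq_Suc[OF digit_seq_Suc[OF d]]] calculation(2) by simp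
        ultimately have "farey_value ?d = 1"
          using farey_value_rec[OF digit_seq_Suc[OF d]] by simp
        then show ?thesis using F 2 by (simp add: x_def)
      next
        case False
        then have "part_len A (d 0) * y < part_len A (d 0)" "0 \<le> part_len A (d 0) * y"
          using y a by simp_all
        then have "x \<in> A (d 0)"
          using xy part_interval[OF part 1] part_len_eq[OF part 1] by simp
        then have i: "part_index A x = d 0" using 1 by (simp add: part_index_eq[OF part])
        have L: "luroth_map A x = y" using i x xy a by (simp add: luroth_map_def)
        have "farey_minkowski A x - farey_value d =
                - ((1 / 2) ^ d 0) * (farey_minkowski A y - farey_value ?d)"
          using fm_rec[OF x] i L F by (simp add: algebra_simps)
        then have "\<bar>farey_minkowski A x - farey_value d\<bar> =
                (1 / 2) ^ d 0 * \<bar>farey_minkowski A y - farey_value ?d\<bar>"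
          by (simp add: abs_mult)
        also have "\<dots> \<le> (1 / 2) ^ 1 * (4 * (1 / 2) ^ n)"
          using Suc.IH[OF digit_seq_Suc[OF d]] 1
          by (intro mult_mono power_decreasing) (auto simp: y_def)
        finally show ?thesis by (simp add: x_def)
      qed
    qed
  qed
  then have b: "\<bar>farey_minkowski A (luroth_value A d) - farey_value d\<bar> \<le> 4 * (1 / 2) ^ n" for n
    using assms by blast
  have "(\<lambda>n. 4 * (1 / 2) ^ n :: real) \<longlonglongrightarrow> 4 * 0"
    by (intro tendsto_mult tendsto_const LIMSEQ_power_zero) simp
  then have "\<bar>farey_minkowski A (luroth_value A d) - farey_value d\<bar> \<le> 4 * 0"
    using b LIMSEQ_le_const by blast
  then show ?thesis by simp
qed

end

end

theory Submission
  imports Defs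
begin

text \<open>
  Let \<open>E\<^sub>c\<close> be the set of points at which the monotone function \<open>\<theta>\<close> has upper derivate greater than
  \<open>c\<close>, and let \<open>\<lambda>\<close> be outer Lebesgue measure. By Vitali's covering theorem \<open>\<lambda> E\<^sub>c \<le> 1 / c\<close>, hence
  \<open>\<lambda> E\<^sub>c \<le> c powr (-1/2)\<close>. The map \<open>L\<close> carries \<open>A\<^sub>n\<close> affinely onto the unit interval and
  \<open>\<theta> x = 2\<^sup>-\<^sup>n (2 - \<theta> (L x))\<close> on \<open>A\<^sub>n\<close>, so up to an endpoint \<open>E\<^sub>c \<inter> A\<^sub>n\<close> is an affine copy, scaled by
  \<open>a\<^sub>n\<close>, of \<open>E\<^sub>d\<close> with \<open>d = c a\<^sub>n 2\<^sup>n\<close>. A bound \<open>\<lambda> E\<^sub>c \<le> K c powr (-1/2)\<close> for all \<open>c\<close> therefore improves to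
  the same bound with \<open>K \<rho>\<close> in place of \<open>K\<close>, where \<open>\<rho> = (\<Sum>n. sqrt (a\<^sub>n 2\<^sup>-\<^sup>n))\<close>. By the inequality of the means
  \<open>\<rho> < 1\<close> unless \<open>a\<^sub>n = 2\<^sup>-\<^sup>n\<close> for all \<open>n\<close>, and iteration gives \<open>\<lambda> E\<^sub>c = 0\<close>.
\<close>

section \<open>Points of large upper derivate\<close>

text \<open>The slope over \<open>{u..v}\<close> is a convex combination of the slopes over
  \<open>{u..x}\<close> and \<open>{x..v}\<close>, so intervals around \<open>x\<close> detect the
  same growth as difference quotients at \<open>x\<close>. In this form they are a Vitali cover and
  behave well under affine maps that reverse the order.\<close>

definition steep_points :: "(real \<Rightarrow> real) \<Rightarrow> real \<Rightarrow> real set" where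
  "steep_points f c = {x \<in> {0<..<1}. \<forall>d>0. \<exists>u v. 0 \<le> u \<and> u \<le> x \<and> x \<le> v \<and> v \<le> 1 \<and>
     u < v \<and> v - u < d \<and> c * (v - u) < f v - f u}"

text \<open>Monotonicity turns disjoint intervals into disjoint image intervals inside
  \<open>{f a..f b}\<close>, whose lengths add up.\<close>

lemma sum_increments_le:
  fixes f :: "real \<Rightarrow> real"
  assumes mono: "mono_on {a..b} f" and "finite I"
    and I: "\<And>u v. (u, v) \<in> I \<Longrightarrow> a \<le> u \<and> u < v \<and> v \<le> b"
    and disj: "pairwise (\<lambda>i j. disjnt {fst i..snd i} {fst j..snd j}) I" and "a \<le> b"
  shows "(\<Sum>i\<in>I. f (snd i) - f (fst i)) \<le> f b - f a"
proof -
  \<comment> \<open>Open, because two image intervals share an endpoint when \<open>f\<close> is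
    constant on the gap between.\<close>
  let ?F = "\<lambda>i. {f (fst i)<..<f (snd i)}"
  have le: "f x \<le> f y" if "a \<le> x" "x \<le> y" "y \<le> b" for x y
    using mono_onD[OF mono, of x y] that by simp
  have I': "a \<le> fst i" "fst i < snd i" "snd i \<le> b" if "i \<in> I" for i
    using I[of "fst i" "snd i"] that by auto
  have "disjnt (?F i) (?F j)" if ij: "i \<in> I" "j \<in> I" "i \<noteq> j" for i j
  proof -
    have "disjnt {fst i..snd i} {fst j..snd j}" using disj ij by (auto simp: pairwise_def)
    then have "snd i < fst j \<or> snd j < fst i"
      using I'[OF ij(1)] I'[OF ij(2)] unfolding disjnt_iff
      by (metis atLeastAtMost_iff less_imp_le linorder_not_less order_refl)
    then have "f (snd i) \<le> f (fst j) \<or> f (snd j) \<le> f (fst i)"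
      using I'[OF ij(1)] I'[OF ij(2)] le by fastforce
    then show ?thesis by (auto simp: disjnt_iff)
  qed
  moreover have "?F i \<in> fmeasurable lborel" for i
    by (cases "f (fst i) \<le> f (snd i)") (auto simp: fmeasurable_def)
  ultimately have "measure lborel (\<Union>i\<in>I. ?F i) = (\<Sum>i\<in>I. measure lborel (?F i))"
    using \<open>finite I\<close> by (intro measure_UNION') (auto simp: pairwise_def)
  also have "\<dots> = (\<Sum>i\<in>I. f (snd i) - f (fst i))"
    using I' le by (intro sum.cong) (auto simp: less_imp_le)
  finally have "(\<Sum>i\<in>I. f (snd i) - f (fst i)) = measure lborel (\<Union>i\<in>I. ?F i)" ..
  also have "\<dots> \<le> measure lborel {f a..f b}"
  proof (rule measure_mono_fmeasurable)
    show "(\<Union>i\<in>I. ?F i) \<subseteq> {f a..f b}"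
    proof
      fix y assume "y \<in> (\<Union>i\<in>I. ?F i)"
      then obtain i where i: "i \<in> I" "f (fst i) < y" "y < f (snd i)" by auto
      then show "y \<in> {f a..f b}"
        using I'[OF i(1)] le[of a "fst i"] le[of "snd i" b] by simp
    qed
  qed (use le[of a b] \<open>a \<le> b\<close> \<open>finite I\<close> in \<open>auto simp: fmeasurable_def\<close>)
  also have "\<dots> = f b - f a" using le[of a b] \<open>a \<le> b\<close> by simp
  finally show ?thesis .
qed

text \<open>A Vitali selection consists of disjoint intervals of slope above \<open>c\<close>. Their
  lengths are less than \<open>1 / c\<close> times the increments of \<open>f\<close>, which total
  at most \<open>f 1 - f 0\<close>.\<close>

lemma steep_points_outer_measure:
  assumes mono: "mono_on {0..1} f" and "0 < c"
  obtains B where "B \<in> lmeasurable" "steep_points f c \<subseteq> B" "measure lebesgue B \<le> (f 1 - f 0) / c"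
proof -
  define K where "K = {(u, v). 0 \<le> u \<and> u < v \<and> v \<le> 1 \<and> c * (v - u) < f v - f u}"
  have K: "0 \<le> fst i" "fst i < snd i" "snd i \<le> 1" "c * (snd i - fst i) < f (snd i) - f (fst i)"
    if "i \<in> K" for i
    using that by (auto simp: K_def)
  \<comment> \<open>Vitali's theorem speaks of balls, hence midpoint and half the length.\<close>
  have cb: "cball ((fst i + snd i) / 2) ((snd i - fst i) / 2) = {fst i..snd i}" for i :: "real \<times> real"
    by (simp add: cball_eq_atLeastAtMost field_simps)
  obtain C where C: "countable C" "C \<subseteq> K" "pairwise (\<lambda>i j. disjnt {fst i..snd i} {fst j..snd j}) C"
    "negligible (steep_points f c - (\<Union>i\<in>C. {fst i..snd i}))"
  proof (rule Vitali_covering_theorem_cballs[of K "\<lambda>i. (snd i - fst i) / 2" "steep_points f c"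
      "\<lambda>i. (fst i + snd i) / 2", unfolded cb])
    fix x d :: real assume x: "x \<in> steep_points f c" and "0 < d"
    obtain u v where "0 \<le> u" "u \<le> x" "x \<le> v" "v \<le> 1" "u < v" "v - u < d" "c * (v - u) < f v - f u"
      using x \<open>0 < d\<close> unfolding steep_points_def by blast
    then show "\<exists>i. i \<in> K \<and> x \<in> {fst i..snd i} \<and> (snd i - fst i) / 2 < d"
      by (intro exI[of _ "(u, v)"]) (auto simp: K_def)
  qed (use K(2) in auto)
  have bound: "measure lebesgue (\<Union>i\<in>I. {fst i..snd i}) \<le> (f 1 - f 0) / c"
    if I: "I \<subseteq> C" "finite I" for I
  proof -
    have IK: "i \<in> K" if "i \<in> I" for i using that I(1) C(2) by blast
    have "measure lebesgue (\<Union>i\<in>I. {fst i..snd i}) \<le> (\<Sum>i\<in>I. measure lebesgue {fst i..snd i})"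
      using I(2) by (intro measure_UNION_le) auto
    also have "\<dots> \<le> (\<Sum>i\<in>I. (f (snd i) - f (fst i)) / c)"
    proof (rule sum_mono)
      fix i assume "i \<in> I"
      then show "measure lebesgue {fst i..snd i} \<le> (f (snd i) - f (fst i)) / c"
        using K[OF IK] \<open>0 < c\<close> by (simp add: pos_le_divide_eq mult.commute less_imp_le)
    qed
    also have "\<dots> = (\<Sum>i\<in>I. f (snd i) - f (fst i)) / c" by (simp add: sum_divide_distrib)
    also have "(\<Sum>i\<in>I. f (snd i) - f (fst i)) \<le> f 1 - f 0"
    proof (rule sum_increments_le[OF mono I(2)])
      show "0 \<le> u \<and> u < v \<and> v \<le> 1" if "(u, v) \<in> I" for u v using K[OF IK[OF that]] by simp
    qed (use pairwise_subset[OF C(3) I(1)] in auto)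
    finally show ?thesis using \<open>0 < c\<close> by (simp add: divide_right_mono)
  qed
  let ?U = "\<Union>i\<in>C. {fst i..snd i}"
  have U: "?U \<in> lmeasurable" "measure lebesgue ?U \<le> (f 1 - f 0) / c"
    using fmeasurable_UN_bound[OF C(1) _ bound] measure_UN_bound[OF C(1) _ bound] by auto
  \<comment> \<open>The selection may miss a null set, which is added to obtain a true
    cover.\<close>
  let ?N = "steep_points f c - ?U"
  have "measure lebesgue (?U \<union> ?N) \<le> measure lebesgue ?U + measure lebesgue ?N"
    using U(1) negligible_imp_sets[OF C(4)] by (intro measure_Un_le) auto
  then have "measure lebesgue (?U \<union> ?N) \<le> (f 1 - f 0) / c"
    using U(2) negligible_imp_measure0[OF C(4)] by simp
  moreover have "?U \<union> ?N \<in> lmeasurable" using U(1) negligible_imp_measurable[OF C(4)] by blast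
  ultimately show ?thesis by (intro that[of "?U \<union> ?N"]) auto
qed

text \<open>Difference quotients of a monotone function are nonnegative, so upper bounds tending to
  0 suffice. Countably many levels keep the exceptional set a countable union.\<close>

lemma has_real_derivative_0_if_not_steep:
  assumes mono: "mono_on {0..1} f" and x: "0 < x" "x < 1"
    and not_steep: "\<And>n. x \<notin> steep_points f (1 / real (Suc n))"
  shows "(f has_real_derivative 0) (at x within {0..1})"
  unfolding has_field_derivative_iff tendsto_iff
proof (intro allI impI)
  fix e :: real assume "0 < e"
  then obtain n where n: "1 / real (Suc n) < e" using reals_Archimedean
    by (metis inverse_eq_divide)
  let ?c = "1 / real (Suc n)"
  from not_steep[of n] x obtain d where "0 < d"
    and d: "\<And>u v. 0 \<le> u \<Longrightarrow> u \<le> x \<Longrightarrow> x \<le> v \<Longrightarrow> v \<le> 1 \<Longrightarrow> u < v \<Longrightarrow> v - u < d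
              \<Longrightarrow> f v - f u \<le> ?c * (v - u)"
    unfolding steep_points_def mem_Collect_eq by (metis greaterThanLessThan_iff not_less)
  have "dist ((f y - f x) / (y - x)) 0 < e" if y: "y \<in> {0..1}" "y \<noteq> x" "dist y x < d" for y
  proof -
    have "\<bar>f y - f x\<bar> \<le> ?c * \<bar>y - x\<bar>"
    proof (cases "x < y")
      case True
      then show ?thesis using d[of x y] mono_onD[OF mono, of x y] y x by (simp add: dist_real_def)
    next
      case False
      then show ?thesis using d[of y x] mono_onD[OF mono, of y x] y x
        by (simp add: dist_real_def abs_minus_commute[of "f y"] abs_minus_commute[of y])
    qed
    then have "\<bar>(f y - f x) / (y - x)\<bar> \<le> ?c" using y(2) by (simp add: abs_divide divide_le_eq)
    then show ?thesis using n by (simp add: dist_real_def)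
  qed
  then show "\<forall>\<^sub>F y in at x within {0..1}. dist ((f y - f x) / (y - x)) 0 < e"
    unfolding eventually_at using \<open>0 < d\<close> by blast
qed

section \<open>The functional equation\<close>

context
  fixes A :: "nat \<Rightarrow> real set"
  assumes part: "luroth_partition A"
begin

lemma farey_minkowski_0: "farey_minkowski A 0 = 0"
  by (simp add: farey_minkowski_def)

lemma farey_minkowski_eq_farey_value:
  "0 \<le> x \<Longrightarrow> x \<le> 1 \<Longrightarrow> farey_minkowski A x = farey_value (luroth_digits A x)"
  using farey_value_empty[OF digit_seq_luroth_digits[OF part]]
  by (auto simp: farey_minkowski_def luroth_digits_0[OF part])

text \<open>Applying \<open>luroth_map\<close> drops the first digit: the later exponents lose that
  summand and the signs flip.\<close>

lemma farey_minkowski_rec: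
  assumes x: "0 < x" "x \<le> 1"
  shows "farey_minkowski A x =
           (1 / 2) ^ part_index A x * (2 - farey_minkowski A (luroth_map A x))"
proof -
  have "luroth_digits A x 0 = part_index A x" using x by (simp add: luroth_digits_0[OF part])
  then show ?thesis
    using x farey_value_rec[OF digit_seq_luroth_digits[OF part, of x]] luroth_map_unit[OF part x]
    by (simp add: farey_minkowski_eq_farey_value luroth_digits_Suc[OF part])
qed

section \<open>Range and monotonicity of \<theta>\<close>

text \<open>A bootstrap: the series gives the crude bound 2, the recursion turns it into
  nonnegativity, and a second use of the recursion, with a factor of at most 1/2, gives the bound
  1.\<close>

lemma farey_minkowski_bounds:
  assumes "0 \<le> x" "x \<le> 1"
  shows "0 \<le> farey_minkowski A x" "farey_minkowski A x \<le> 1"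
proof -
  have le_2: "\<bar>farey_minkowski A x\<bar> \<le> 2" if "0 \<le> x" "x \<le> 1" for x
    using farey_value_bound[OF digit_seq_luroth_digits[OF part that]] that
    by (simp add: farey_minkowski_eq_farey_value)
  have nonneg: "0 \<le> farey_minkowski A x" if "0 \<le> x" "x \<le> 1" for x
  proof (cases "x = 0")
    case False
    then have x: "0 < x" using that by simp
    note L = luroth_map_unit[OF part x that(2)]
    have "\<bar>farey_minkowski A (luroth_map A x)\<bar> \<le> 2"
      using le_2 L(4,5) by simp
    then show ?thesis unfolding farey_minkowski_rec[OF x that(2)] by simp
  qed (simp add: farey_minkowski_0)
  show "0 \<le> farey_minkowski A x" by (rule nonneg[OF assms])
  show "farey_minkowski A x \<le> 1"
  proof (cases "x = 0")
    case False
    then have x: "0 < x" using assms by simp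
    note L = luroth_map_unit[OF part x assms(2)]
    have "(1 / 2) ^ part_index A x \<le> (1 / 2 :: real) ^ 1"
      using L(1) by (intro power_decreasing) auto
    then have "(1 / 2) ^ part_index A x * (2 - farey_minkowski A (luroth_map A x)) \<le> 1 / 2 * 2"
      using nonneg[of "luroth_map A x"] le_2[of "luroth_map A x"] L(4,5) by (intro mult_mono') auto
    then show ?thesis unfolding farey_minkowski_rec[OF x assms(2)] by simp
  qed (simp add: farey_minkowski_0)
qed

text \<open>A violation of monotonicity within one \<open>A m\<close> passes, by the order-reversing
  \<open>luroth_map\<close>, to a violation at least twice as large. Hence it is at most
  \<open>(1 / 2) ^ k\<close> for every \<open>k\<close>.\<close>

lemma farey_minkowski_mono: "mono_on {0..1} (farey_minkowski A)"
proof (rule mono_onI)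
  let ?F = "farey_minkowski A"
  have approx: "?F x - ?F y \<le> (1 / 2) ^ k" if "0 \<le> x" "x \<le> y" "y \<le> 1" for x y k
    using that
  proof (induction k arbitrary: x y)
    case 0
    then show ?case using farey_minkowski_bounds[of x] farey_minkowski_bounds[of y] by simp
  next
    case (Suc k)
    show ?case
    proof (cases "x = 0")
      case True
      then have "?F x - ?F y \<le> 0"
        using farey_minkowski_bounds[of y] Suc.prems by (simp add: farey_minkowski_0)
      also have "0 \<le> (1 / 2 :: real) ^ Suc k" by simp
      finally show ?thesis .
    next
      case False
      then have x: "0 < x" "x \<le> 1" and y: "0 < y" "y \<le> 1" using Suc.prems by auto
      define m n where "m = part_index A x" and "n = part_index A y"
      note Lx = luroth_map_unit[OF part x, folded m_def] and Ly = luroth_map_unit[OF part y, folded n_def]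
      have Fx: "?F x = (1 / 2) ^ m * (2 - ?F (luroth_map A x))"
        and Fy: "?F y = (1 / 2) ^ n * (2 - ?F (luroth_map A y))"
        using farey_minkowski_rec x y by (simp_all add: m_def n_def)
      have "n \<le> m"
        using part_order[OF part Lx(1) _ Ly(2) Lx(2)] Suc.prems(2) by (meson not_le)
      show ?thesis
      proof (cases "n = m")
        case True
        have "luroth_map A y \<le> luroth_map A x"
          using Lx(3) Ly(3) True Suc.prems(2) part_len_pos[OF part Lx(1)]
          by (simp add: divide_right_mono)
        then have "?F (luroth_map A y) - ?F (luroth_map A x) \<le> (1 / 2) ^ k"
          using Lx(4,5) Ly(4,5) by (intro Suc.IH) auto
        moreover have "(1 / 2) ^ m \<le> (1 / 2 :: real) ^ 1" using Lx(1) by (intro power_decreasing) auto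
        moreover have "?F x - ?F y = (1 / 2) ^ m * (?F (luroth_map A y) - ?F (luroth_map A x))"
          using Fx Fy True by (simp add: algebra_simps)
        ultimately have "?F x - ?F y \<le> (1 / 2) ^ m * (1 / 2) ^ k"
          by (simp add: mult_left_mono)
        also have "\<dots> \<le> 1 / 2 * (1 / 2) ^ k"
          using \<open>(1 / 2) ^ m \<le> (1 / 2 :: real) ^ 1\<close> by (intro mult_right_mono) auto
        finally show ?thesis by simp
      next
        case False
        \<comment> \<open>The values of \<theta> on \<open>A m\<close> lie between
          \<open>(1 / 2) ^ m\<close> and \<open>2 * (1 / 2) ^ m\<close>; here \<open>n < m\<close>,
          so they do not exceed those on \<open>A n\<close>.\<close>
        have "?F x \<le> (1 / 2) ^ m * 2"
          unfolding Fx using farey_minkowski_bounds[of "luroth_map A x"] Lx(4,5)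
          by (intro mult_left_mono) auto
        also have "\<dots> \<le> (1 / 2) ^ Suc n * 2"
          using False \<open>n \<le> m\<close> by (intro mult_right_mono power_decreasing) auto
        also have "\<dots> = (1 / 2) ^ n * 1" by simp
        also have "\<dots> \<le> ?F y"
          unfolding Fy using farey_minkowski_bounds[of "luroth_map A y"] Ly(4,5)
          by (intro mult_left_mono) auto
        finally have "?F x - ?F y \<le> 0" by simp
        also have "0 \<le> (1 / 2 :: real) ^ Suc k" by simp
        finally show ?thesis .
      qed
    qed
  qed
  fix x y :: real assume "x \<in> {0..1}" "y \<in> {0..1}" "x \<le> y"
  then have "?F x - ?F y \<le> (1 / 2) ^ k" for k using approx by simp
  moreover have "(\<lambda>k. (1 / 2 :: real) ^ k) \<longlonglongrightarrow> 0" by (rule LIMSEQ_power_zero) simp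
  ultimately have "?F x - ?F y \<le> 0" using LIMSEQ_le_const by blast
  then show "?F x \<le> ?F y" by simp
qed

section \<open>Steep points under the branches of \<open>luroth_map\<close>\<close>

text \<open>The recursion read along the inverse branch. The value \<open>y = 1\<close> would give
  the left endpoint, which belongs to \<open>A (Suc n)\<close>.\<close>

lemma farey_minkowski_on_part:
  assumes "1 \<le> n" and y: "0 \<le> y" "y < 1"
  shows "farey_minkowski A (part_tail A n - part_len A n * y) =
           (1 / 2) ^ n * (2 - farey_minkowski A y)"
proof -
  let ?x = "part_tail A n - part_len A n * y"
  have a: "0 < part_len A n" by (rule part_len_pos[OF part assms(1)])
  then have "part_len A n * y < part_len A n" "0 \<le> part_len A n * y" using y by simp_all
  then have xA: "?x \<in> A n"
    using part_interval[OF part assms(1)] part_len_eq[OF part assms(1)] by simp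
  then have "part_index A ?x = n" by (rule part_index_eq[OF part assms(1)])
  moreover have "0 < ?x" "?x \<le> 1"
    using xA part_interval[OF part assms(1)] part_tail_pos[OF part, of "Suc n"]
      part_tail_le_1[OF part assms(1)] by auto
  ultimately show ?thesis using farey_minkowski_rec[of ?x] a by (simp add: luroth_map_def)
qed

text \<open>Under \<open>luroth_map\<close> lengths in \<open>A n\<close> are divided by
  \<open>part_len A n\<close> and increments of \<theta> are multiplied by \<open>2 ^ n\<close>, so
  slopes gain the factor \<open>part_len A n * 2 ^ n\<close>.\<close>

lemma steep_points_on_part:
  assumes n: "1 \<le> n" and "0 < c"
    and x: "x \<in> steep_points (farey_minkowski A) c" "part_tail A (Suc n) < x" "x < part_tail A n"
  shows "x \<in> (\<lambda>y. - part_len A n *\<^sub>R y + part_tail A n) `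
           steep_points (farey_minkowski A) (c * (part_len A n * 2 ^ n))"
proof -
  let ?F = "farey_minkowski A" and ?t = "part_tail A n" and ?a = "part_len A n"
  define s where "s = part_tail A (Suc n)"
  have a: "0 < ?a" and s: "s = ?t - ?a"
    using part_len_pos[OF part n] part_len_eq[OF part n] by (simp_all add: s_def)
  define y where "y = (?t - x) / ?a"
  have x_eq: "x = - ?a *\<^sub>R y + ?t" using a by (simp add: y_def)
  have y: "0 < y" "y < 1" using x(2,3) a s by (simp_all add: y_def s_def)
  have "\<exists>u v. 0 \<le> u \<and> u \<le> y \<and> y \<le> v \<and> v \<le> 1 \<and> u < v \<and> v - u < d \<and>
          c * (?a * 2 ^ n) * (v - u) < ?F v - ?F u" if "0 < d" for d
  proof -
    \<comment> \<open>The first entry makes the image interval shorter than \<open>d\<close>; the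
      other two keep \<open>{u..v}\<close> strictly inside \<open>A n\<close>.\<close>
    let ?d = "min (?a * d) (min (x - s) (?t - x))"
    have "0 < ?d" using x(2,3) a \<open>0 < d\<close> by (simp add: s_def)
    then obtain u v where uv: "u \<le> x" "x \<le> v" "u < v" "v - u < ?d" "c * (v - u) < ?F v - ?F u"
      using x(1) unfolding steep_points_def by blast
    \<comment> \<open>The branch is decreasing, so the endpoints change places.\<close>
    define u' v' where "u' = (?t - v) / ?a" and "v' = (?t - u) / ?a"
    have uv_eq: "u = ?t - ?a * v'" "v = ?t - ?a * u'" using a by (simp_all add: u'_def v'_def)
    have "s < u" "v < ?t" using uv by auto
    then have uv': "0 < u'" "v' < 1" using a s by (simp_all add: u'_def v'_def)
    have le: "u' \<le> y" "y \<le> v'" "u' < v'"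
      using uv a by (simp_all add: u'_def v'_def y_def divide_right_mono divide_strict_right_mono)
    have Fv: "?F v = (1 / 2) ^ n * (2 - ?F u')" and Fu: "?F u = (1 / 2) ^ n * (2 - ?F v')"
      unfolding uv_eq using farey_minkowski_on_part[OF n] uv' le by auto
    have len: "v - u = ?a * (v' - u')" using uv_eq by (simp add: algebra_simps)
    have "?a * (v' - u') < ?a * d" using len uv(4) by simp
    then have small: "v' - u' < d" using a by simp
    have "c * (?a * (v' - u')) < (1 / 2) ^ n * (?F v' - ?F u')"
      using uv(5) Fv Fu unfolding len by (simp add: algebra_simps)
    then have "2 ^ n * (c * (?a * (v' - u'))) < 2 ^ n * ((1 / 2) ^ n * (?F v' - ?F u'))"
      by simp
    also have "\<dots> = ?F v' - ?F u'" by (simp add: power_one_over)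
    finally have "c * (?a * 2 ^ n) * (v' - u') < ?F v' - ?F u'" by (simp add: mult_ac)
    then show ?thesis using uv' le small by (intro exI[of _ u'] exI[of _ v']) auto
  qed
  then have "y \<in> steep_points ?F (c * (?a * 2 ^ n))" using y unfolding steep_points_def by simp
  then show ?thesis using x_eq by blast
qed

section \<open>Contraction of the bound on the steep points\<close>

lemma part_len_sums: "(\<lambda>n. part_len A (Suc n)) sums 1"
proof -
  have eq: "(\<Sum>k<n. part_len A (Suc k)) = 1 - part_tail A (Suc n)" for n
    using part_tail_1[OF part] by (induction n) (simp_all add: part_len_eq[OF part])
  \<comment> \<open>The value of \<open>suminf\<close> is informative only once convergence is
    known; the telescoping sums supply it.\<close>
  have "summable (\<lambda>n. part_len A (Suc n))"
  proof (rule bounded_imp_summable)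
    show "0 \<le> part_len A (Suc n)" for n using part_len_pos[OF part, of "Suc n"] by simp
    show "(\<Sum>k\<le>n. part_len A (Suc k)) \<le> 1" for n
      unfolding lessThan_Suc_atMost[symmetric] eq using part_tail_pos[OF part, of "Suc (Suc n)"] by simp
  qed
  moreover have "(\<Sum>n. part_len A (Suc n)) = 1"
    using part_tail_1[OF part] by (simp add: part_tail_def)
  ultimately show ?thesis by (simp add: sums_iff)
qed

text \<open>The lengths determine the partition: successive subtraction from 1 gives the tails,
  which are the endpoints.\<close>

lemma non_dyadic_part_len:
  assumes "non_dyadic A"
  obtains n where "part_len A (Suc n) \<noteq> (1 / 2) ^ Suc n"
proof -
  have False if *: "\<And>n. part_len A (Suc n) = (1 / 2) ^ Suc n"
  proof -
    have tail: "part_tail A (Suc n) = (1 / 2) ^ n" for n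
    proof (induction n)
      case (Suc n)
      then show ?case using part_len_eq[OF part, of "Suc n"] *[of n] by simp
    qed (use part_tail_1[OF part] in simp)
    have "A n = dyadic_partition n" if "n \<in> {1..}" for n
    proof -
      obtain m where "n = Suc m" using \<open>n \<in> {1..}\<close> by (cases n) auto
      then show ?thesis
        using part_interval[OF part, of n] tail[of m] tail[of n]
        by (simp add: dyadic_partition_def power_one_over)
    qed
    then have "A ` {1..} = dyadic_partition ` {1..}" by (rule image_cong[OF refl])
    then show False using assms by (simp add: non_dyadic_def)
  qed
  then show ?thesis using that by blast
qed

text \<open>The sum is the Bhattacharyya coefficient of the lengths and the weights
  \<open>(1 / 2) ^ Suc n\<close>. The arithmetic means sum to 1, and one index with different
  entries leaves a positive gap.\<close>

lemma sqrt_part_len_sum_less_1: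
  assumes "non_dyadic A"
  shows "summable (\<lambda>n. sqrt (part_len A (Suc n) * (1 / 2) ^ Suc n))"
    and "(\<Sum>n. sqrt (part_len A (Suc n) * (1 / 2) ^ Suc n)) < 1"
proof -
  let ?a = "\<lambda>n. part_len A (Suc n)" and ?b = "\<lambda>n. (1 / 2 :: real) ^ Suc n"
  let ?m = "\<lambda>n. (?a n + ?b n) / 2" and ?g = "\<lambda>n. sqrt (?a n * ?b n)"
  have a: "0 < ?a n" for n by (simp add: part_len_pos[OF part])
  have m: "?m sums 1"
    using sums_divide[OF sums_add[OF part_len_sums power_half_series], of 2] by simp
  have le: "?g n \<le> ?m n" for n using a[of n] by (intro arith_geo_mean_sqrt) auto
  show g: "summable ?g"
  proof (rule summable_comparison_test'[OF sums_summable[OF m]])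
    show "norm (?g n) \<le> ?m n" for n using le[of n] a[of n] by (simp add: abs_mult)
  qed
  obtain k where k: "?a k \<noteq> ?b k" using non_dyadic_part_len[OF assms] by blast
  have "?g k < ?m k"
  proof (rule real_less_lsqrt)
    have "0 < (?a k - ?b k)\<^sup>2" using k by simp
    then show "?a k * ?b k < (?m k)\<^sup>2" by (simp add: power2_eq_square field_simps)
  qed (use a[of k] in auto)
  then have "0 < (\<Sum>n. ?m n - ?g n)"
    using le by (intro suminf_pos2[of _ k] summable_diff g sums_summable[OF m]) auto
  then show "suminf ?g < 1"
    using suminf_diff[OF sums_summable[OF m] g] sums_unique[OF m] by simp
qed

section \<open>One contraction step\<close>

text \<open>Outer measure is expressed through measurable covers. The bound is assumed at all levels
  because each branch leads from \<open>c\<close> to another level.\<close>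

lemma steep_points_contraction:
  assumes "non_dyadic A" and "0 \<le> K"
    and cover: "\<And>c. 0 < c \<Longrightarrow> \<exists>B\<in>lmeasurable. steep_points (farey_minkowski A) c \<subseteq> B \<and>
                  measure lebesgue B \<le> K / sqrt c"
    and "0 < c"
  shows "\<exists>B\<in>lmeasurable. steep_points (farey_minkowski A) c \<subseteq> B \<and>
           measure lebesgue B \<le> (\<Sum>n. sqrt (part_len A (Suc n) * (1 / 2) ^ Suc n)) * K / sqrt c"
proof -
  let ?E = "steep_points (farey_minkowski A)"
  let ?a = "\<lambda>n. part_len A (Suc n)" and ?t = "\<lambda>n. part_tail A (Suc n)"
  let ?g = "\<lambda>n. sqrt (?a n * (1 / 2) ^ Suc n)"
  have a: "0 < ?a n" for n by (simp add: part_len_pos[OF part])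
  have "\<exists>B\<in>lmeasurable. ?E (c * (?a n * 2 ^ Suc n)) \<subseteq> B \<and>
          measure lebesgue B \<le> K / sqrt (c * (?a n * 2 ^ Suc n))" for n
    using cover[of "c * (?a n * 2 ^ Suc n)"] a[of n] \<open>0 < c\<close> by simp
  then obtain B where B: "\<And>n. B n \<in> lmeasurable" "\<And>n. ?E (c * (?a n * 2 ^ Suc n)) \<subseteq> B n"
    "\<And>n. measure lebesgue (B n) \<le> K / sqrt (c * (?a n * 2 ^ Suc n))"
    by metis
  define D where "D n = (\<lambda>y. - ?a n *\<^sub>R y + ?t n) ` B n" for n
  have D: "D n \<in> lmeasurable" for n
  proof -
    have "emeasure lebesgue (D n) < \<infinity>"
      using B(1)[of n] unfolding D_def emeasure_lebesgue_affine
      by (auto simp: fmeasurable_def ennreal_mult_less_top)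
    \<comment> \<open>A scaled image is a preimage under the inverse scaling, a measurable
      map.\<close>
    moreover have "D n \<in> sets lebesgue"
    proof -
      have "((*\<^sub>R) (- ?a n)) ` B n = ((*\<^sub>R) (- 1 / ?a n)) -` B n"
        using a[of n] by (auto simp: image_iff field_simps intro!: bexI[of _ "- x / ?a n" for x])
      then have "((*\<^sub>R) (- ?a n)) ` B n \<in> sets lebesgue"
        using measurable_sets[OF lebesgue_measurable_scaling[of "- 1 / ?a n"] fmeasurableD[OF B(1)[of n]]]
        by simp
      from lebesgue_sets_translation[OF this, of "?t n"] show ?thesis
        by (simp add: D_def image_image add.commute)
    qed
    ultimately show ?thesis by (simp add: fmeasurable_def)
  qed
  have D_measure: "measure lebesgue (D n) \<le> ?g n * (K / sqrt c)" for n
  proof -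
    have "measure lebesgue (D n) = ?a n * measure lebesgue (B n)"
      unfolding D_def measure_lebesgue_affine using a[of n] by simp
    also have "\<dots> \<le> ?a n * (K / sqrt (c * (?a n * 2 ^ Suc n)))"
      using B(3) a[of n] by (intro mult_left_mono) auto
    \<comment> \<open>One root cancels against the denominator, the other stays in
      \<open>?g n\<close>.\<close>
    also have "\<dots> = (sqrt (?a n) * sqrt (?a n)) * (K / sqrt (c * (?a n * 2 ^ Suc n)))"
      using a[of n] by simp
    also have "\<dots> = ?g n * (K / sqrt c)"
      using a[of n] \<open>0 < c\<close>
      by (simp add: real_sqrt_mult real_sqrt_divide power_one_over field_simps del: real_sqrt_mult_self)
    finally show ?thesis .
  qed
  have bound: "measure lebesgue (\<Union>n\<in>I. D n) \<le> suminf ?g * K / sqrt c" if "finite I" for I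
  proof -
    have "measure lebesgue (\<Union>n\<in>I. D n) \<le> (\<Sum>n\<in>I. measure lebesgue (D n))"
      using that D by (intro measure_UNION_le) auto
    also have "\<dots> \<le> (\<Sum>n\<in>I. ?g n * (K / sqrt c))" using D_measure by (rule sum_mono)
    also have "\<dots> = (\<Sum>n\<in>I. ?g n) * (K / sqrt c)"
      by (rule sum_distrib_right[symmetric])
    also have "\<dots> \<le> suminf ?g * (K / sqrt c)"
      using that a \<open>0 \<le> K\<close> \<open>0 < c\<close>
      by (intro mult_right_mono sum_le_suminf sqrt_part_len_sum_less_1(1)[OF assms(1)])
        (auto simp: less_imp_le)
    finally show ?thesis by simp
  qed
  \<comment> \<open>The branches handle only interior points of the intervals; \<open>?N\<close>
    collects the right endpoints, a countable set.\<close>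
  let ?U = "\<Union>n. D n" and ?N = "range ?t"
  have U: "?U \<in> lmeasurable" "measure lebesgue ?U \<le> suminf ?g * K / sqrt c"
    using fmeasurable_UN_bound[of UNIV D, OF _ D bound] measure_UN_bound[of UNIV D, OF _ D bound] by auto
  have N: "negligible ?N" by (simp add: negligible_iff_null_sets null_sets_completionI countable_imp_null_set_lborel)
  have "measure lebesgue (?U \<union> ?N) \<le> measure lebesgue ?U + measure lebesgue ?N"
    using U(1) negligible_imp_sets[OF N] by (intro measure_Un_le) auto
  then have "measure lebesgue (?U \<union> ?N) \<le> suminf ?g * K / sqrt c"
    using U(2) negligible_imp_measure0[OF N] by simp
  moreover have "?U \<union> ?N \<in> lmeasurable" using U(1) negligible_imp_measurable[OF N] by blast
  moreover have "?E c \<subseteq> ?U \<union> ?N"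
  proof
    fix x assume x: "x \<in> ?E c"
    then have "0 < x" "x \<le> 1" by (auto simp: steep_points_def)
    then obtain m where m: "1 \<le> m" "x \<in> A m" using part_cover[OF part] by blast
    then obtain n where n: "m = Suc n" by (cases m) auto
    show "x \<in> ?U \<union> ?N"
    proof (cases "x = ?t n")
      case False
      then have "x \<in> (\<lambda>y. - ?a n *\<^sub>R y + ?t n) ` ?E (c * (?a n * 2 ^ Suc n))"
        using m n part_interval[OF part m(1)] x \<open>0 < c\<close> by (intro steep_points_on_part) auto
      then have "x \<in> D n" using B(2)[of n] unfolding D_def by blast
      then show ?thesis by blast
    qed blast
  qed
  ultimately show ?thesis by blast
qed

section \<open>Start and iteration of the bound\<close>

text \<open>The iteration starts with \<open>K = 1\<close>: the unit interval serves for
  \<open>c \<le> 1\<close>, the Vitali bound \<open>1 / c\<close> beyond.\<close>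

lemma steep_points_initial_bound:
  assumes "0 < c"
  shows "\<exists>B\<in>lmeasurable. steep_points (farey_minkowski A) c \<subseteq> B \<and> measure lebesgue B \<le> 1 / sqrt c"
proof (cases "c \<le> 1")
  case True
  have "steep_points (farey_minkowski A) c \<subseteq> {0..1}" by (auto simp: steep_points_def)
  moreover have "measure lebesgue {0..1::real} \<le> 1 / sqrt c" using assms True by simp
  ultimately show ?thesis by (intro bexI[of _ "{0..1}"]) auto
next
  case False
  obtain B where B: "B \<in> lmeasurable" "steep_points (farey_minkowski A) c \<subseteq> B"
    "measure lebesgue B \<le> (farey_minkowski A 1 - farey_minkowski A 0) / c"
    using steep_points_outer_measure[OF farey_minkowski_mono assms] by blast
  note B(3)
  also have "\<dots> \<le> 1 / c"
    using farey_minkowski_bounds[of 1] assms by (simp add: farey_minkowski_0 divide_right_mono)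
  also have "\<dots> \<le> 1 / sqrt c"
    using False real_sqrt_le_mono[of c "c * c"] by (intro divide_left_mono) auto
  finally show ?thesis using B by blast
qed

lemma steep_points_negligible:
  assumes "non_dyadic A" "0 < c"
  shows "negligible (steep_points (farey_minkowski A) c)"
proof -
  define \<rho> where "\<rho> = (\<Sum>n. sqrt (part_len A (Suc n) * (1 / 2) ^ Suc n))"
  have \<rho>: "0 \<le> \<rho>" "\<rho> < 1"
    unfolding \<rho>_def using sqrt_part_len_sum_less_1[OF assms(1)] part_len_pos[OF part]
    by (auto intro!: suminf_nonneg simp: less_imp_le)
  \<comment> \<open>\<open>c\<close> is kept general, since the contraction uses the previous bound
    at other levels.\<close>
  have cover: "\<exists>B\<in>lmeasurable. steep_points (farey_minkowski A) c \<subseteq> B \<and>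
          measure lebesgue B \<le> \<rho> ^ k / sqrt c" if "0 < c" for k c
    using that
  proof (induction k arbitrary: c)
    case 0
    then show ?case using steep_points_initial_bound by simp
  next
    case (Suc k)
    show ?case
      using steep_points_contraction[OF assms(1) _ Suc.IH Suc.prems, folded \<rho>_def] \<rho> by simp
  qed
  have lim: "(\<lambda>k. \<rho> ^ k / sqrt c) \<longlonglongrightarrow> 0 / sqrt c"
    using \<rho> assms(2) by (intro tendsto_divide LIMSEQ_power_zero) auto
  show ?thesis
    unfolding negligible_outer
  proof (intro allI impI)
    fix e :: real assume "0 < e"
    then obtain k where "\<rho> ^ k / sqrt c < e"
      using order_tendstoD(2)[OF lim, of e] eventually_sequentially by auto
    then show "\<exists>T. steep_points (farey_minkowski A) c \<subseteq> T \<and> T \<in> lmeasurable \<and> measure lebesgue T < e"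
      using cover[OF assms(2), of k] by (meson le_less_trans)
  qed
qed

end

theorem proposition3p5:
  fixes A :: "nat \<Rightarrow> real set"
  assumes "luroth_partition A"
    and "non_dyadic A"
  shows "AE x in lebesgue_on {0..1}.
           (farey_minkowski A has_real_derivative 0) (at x within {0..1})"
proof -
  \<comment> \<open>Steep points are defined only in the open interval, so 0 and 1 are put into the
    null set by hand.\<close>
  let ?N = "{0, 1} \<union> (\<Union>n. steep_points (farey_minkowski A) (1 / real (Suc n)))"
  have "negligible ?N"
    using steep_points_negligible[OF assms]
    by (intro negligible_Un negligible_countable_Union) auto
  then have "AE x in lebesgue. x \<notin> ?N"
    by (intro AE_not_in) (simp add: negligible_iff_null_sets)
  then have "AE x in lebesgue. x \<in> {0..1} \<longrightarrow>
               (farey_minkowski A has_real_derivative 0) (at x within {0..1})"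
  proof (rule eventually_mono, intro impI)
    fix x :: real assume "x \<notin> ?N" "x \<in> {0..1}"
    then show "(farey_minkowski A has_real_derivative 0) (at x within {0..1})"
      by (intro has_real_derivative_0_if_not_steep[OF farey_minkowski_mono[OF assms(1)]])
        (auto simp: less_le)
  qed
  then show ?thesis by (subst AE_restrict_space_iff) auto
qed

end
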